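(* For every $n\in\mathbb N$ there exist a cubic unit $\rho$ (an algebraic unit of degree $3$ over $\mathbb Q$, with $\mathbb Q(\rho)$ totally real) and an element $\alpha\in\mathbb Z[\rho]$ that is indecomposable in $\mathbb Z[\rho]$ such that \[ \min_{\delta\in\mathbb Z[\rho]^{\vee,+}}\mathrm{Tr}(\alpha\delta)>n . \]
   Context: Let $K$ be a totally real number field and $\mathcal O\subseteq\mathcal O_K$ an order in $K$. An element $\alpha\in K$ is totally positive if $\sigma(\alpha)>0$ for every embedding $\sigma:K\to\mathbb R$. $\mathcal O^+$ is the set of totally positive elements of $\mathcal O$. An element $\alpha\in\mathcal O^+$ is indecomposable in $\mathcal O$ if it cannot be written as $\alpha=\beta+\gamma$ with $\beta,\gamma\in\mathcal O^+$. $\mathrm{Tr}(\alpha)=\sum_\sigma\sigma(\alpha)$ is the trace from $K$ to $\mathbb Q$. The codifferent of $\mathcal O$ is $\mathcal O^\vee=\{\delta\in K:\mathrm{Tr}(\alpha\delta)\in\mathbb Z\text{ for all }\alpha\in\mathcal O\}$, and $\mathcal O^{\vee,+}$ is the set of totally positive elements of $\mathcal O^\vee$. Here $\mathcal O=\mathbb Z[\rho]$ and $K=\mathbb Q(\rho)$. *)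

theory Defs
  imports Complex_Main "HOL-Computational_Algebra.Polynomial" "HOL-Library.FuncSet"
begin

text \<open>Number fields and their orders are represented as subsets of an ambient field
  (the complex numbers in the application).\<close>

definition is_subring :: "'a::ring_1 set \<Rightarrow> bool" where
  "is_subring S \<longleftrightarrow> 1 \<in> S \<and> (\<forall>x\<in>S. \<forall>y\<in>S. x - y \<in> S \<and> x * y \<in> S)"

definition is_subfield :: "'a::field set \<Rightarrow> bool" where
  "is_subfield S \<longleftrightarrow> is_subring S \<and> (\<forall>x\<in>S. inverse x \<in> S)"

definition int_adjoin :: "'a::ring_1 \<Rightarrow> 'a set" where
  "int_adjoin x = is_subring hull {x}"

text \<open>In characteristic zero the smallest subfield containing \<open>x\<close> is \<open>\<rat>(x)\<close>.\<close>

definition rat_adjoin :: "'a::field_char_0 \<Rightarrow> 'a set" where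
  "rat_adjoin x = is_subfield hull {x}"

definition algebraic_unit :: "'a::field_char_0 \<Rightarrow> bool" where
  "algebraic_unit x \<longleftrightarrow> algebraic_int x \<and> (\<exists>y. algebraic_int y \<and> x * y = 1)"

definition is_minimal_poly :: "rat poly \<Rightarrow> 'a::field_char_0 \<Rightarrow> bool" where
  "is_minimal_poly p x \<longleftrightarrow>
     irreducible p \<and> lead_coeff p = 1 \<and> poly (map_poly of_rat p) x = 0"

definition cubic_unit :: "'a::field_char_0 \<Rightarrow> bool" where
  "cubic_unit x \<longleftrightarrow> algebraic_unit x \<and> (\<exists>p. is_minimal_poly p x \<and> degree p = 3)"

text \<open>Embeddings are taken to be extensional (\<open>undefined\<close> outside \<open>K\<close>), so that two
  embeddings agreeing on \<open>K\<close> are equal; otherwise the trace below would not be a sum over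
  the embeddings of \<open>K\<close>.\<close>

definition embeddings :: "'a::field set \<Rightarrow> ('a \<Rightarrow> 'b::field) set" where
  "embeddings K = {\<sigma> \<in> extensional K. \<sigma> 1 = 1 \<and>
     (\<forall>x\<in>K. \<forall>y\<in>K. \<sigma> (x + y) = \<sigma> x + \<sigma> y \<and> \<sigma> (x * y) = \<sigma> x * \<sigma> y)}"

definition totally_real :: "'a::field_char_0 set \<Rightarrow> bool" where
  "totally_real K \<longleftrightarrow> (\<forall>\<sigma> \<in> (embeddings K :: ('a \<Rightarrow> complex) set). \<sigma> ` K \<subseteq> \<real>)"

definition totally_positive :: "'a::field_char_0 set \<Rightarrow> 'a \<Rightarrow> bool" where
  "totally_positive K x \<longleftrightarrow>
     x \<in> K \<and> (\<forall>\<sigma> \<in> (embeddings K :: ('a \<Rightarrow> real) set). \<sigma> x > 0)"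

definition positive_part :: "'a::field_char_0 set \<Rightarrow> 'a set \<Rightarrow> 'a set" where
  "positive_part K A = {x \<in> A. totally_positive K x}"

definition indecomposable :: "'a::field_char_0 set \<Rightarrow> 'a set \<Rightarrow> 'a \<Rightarrow> bool" where
  "indecomposable K R x \<longleftrightarrow> x \<in> positive_part K R \<and>
     \<not> (\<exists>y \<in> positive_part K R. \<exists>z \<in> positive_part K R. x = y + z)"

text \<open>For a totally real \<open>K\<close> the real embeddings are all the embeddings, so this is the trace
  from \<open>K\<close> to \<open>\<rat>\<close>, regarded as a real number.\<close>

definition field_trace :: "'a::field_char_0 set \<Rightarrow> 'a \<Rightarrow> real" where
  "field_trace K x = (\<Sum>\<sigma> \<in> embeddings K. \<sigma> x)"

definition codifferent :: "'a::field_char_0 set \<Rightarrow> 'a set \<Rightarrow> 'a set" where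
  "codifferent K R = {d \<in> K. \<forall>x\<in>R. field_trace K (x * d) \<in> \<int>}"

end

theory Submission
  imports Defs "HOL-Computational_Algebra.Field_as_Ring"
    "HOL-Computational_Algebra.Polynomial_Factorial"
begin

text \<open>Let \<open>\<rho>\<close> be a root of \<open>x (x - a) (x - b) - 1\<close> with \<open>b = 9 a\<close>. The conjugates lie
  close to \<open>0\<close>, \<open>a\<close> and \<open>b\<close>, and the middle one is slightly smaller than \<open>a\<close>.
  Take \<open>\<alpha> = 1 + (a - 1) (\<rho> - 1) (\<rho> - a)\<close>, whose middle conjugate lies below \<open>1\<close>.
  If \<open>\<alpha> = \<beta> + \<gamma>\<close> with totally positive summands, divided differences at the three
  conjugates bound the coordinates of \<open>\<beta>\<close> and \<open>\<gamma>\<close>, and positivity then forces the values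
  of both at \<open>a\<close> to be positive integers, although they add up to \<open>1\<close>.

  For \<open>\<delta>\<close> totally positive in the codifferent, \<open>Tr(\<alpha> \<delta>) = u + (a - 1) t\<close> with the integers
  \<open>u = Tr \<delta> \<ge> 1\<close> and \<open>t = Tr((\<rho> - 1) (\<rho> - a) \<delta>)\<close>. If \<open>t \<ge> 1\<close> this is at least \<open>a\<close>.
  Otherwise the middle conjugate of \<open>\<delta>\<close>, the only one that contributes negatively to \<open>t\<close>,
  must be at least \<open>2 a\<close>, and again the trace is at least \<open>a\<close>.\<close>

subsection \<open>Embeddings of a simple extension of the rationals\<close>

lemma is_subring_hull: "is_subring (is_subring hull S)"
  by (rule hull_in) (auto simp: is_subring_def)

lemma is_subfield_hull: "is_subfield (is_subfield hull S)"
  by (rule hull_in) (auto simp: is_subfield_def is_subring_def)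

lemma is_subring_zero: "is_subring S \<Longrightarrow> 0 \<in> S"
  unfolding is_subring_def by (metis diff_self)

lemma is_subring_add:
  assumes "is_subring S" "x \<in> S" "y \<in> S"
  shows "x + y \<in> S"
proof -
  have "0 - y \<in> S"
    using assms is_subring_zero unfolding is_subring_def by blast
  then have "x - (0 - y) \<in> S"
    using assms unfolding is_subring_def by blast
  then show ?thesis by simp
qed

lemma is_subring_diff: "is_subring S \<Longrightarrow> x \<in> S \<Longrightarrow> y \<in> S \<Longrightarrow> x - y \<in> S"
  and is_subring_mult: "is_subring S \<Longrightarrow> x \<in> S \<Longrightarrow> y \<in> S \<Longrightarrow> x * y \<in> S"
  and is_subring_one: "is_subring S \<Longrightarrow> 1 \<in> S"
  by (auto simp: is_subring_def)

lemma is_subring_of_int: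
  assumes "is_subring S"
  shows "of_int k \<in> S"
proof (induction k rule: int_induct[where k = 0])
  case base
  then show ?case using is_subring_zero[OF assms] by simp
next
  case (step1 i)
  then show ?case using is_subring_add[OF assms _ is_subring_one[OF assms]] by simp
next
  case (step2 i)
  then show ?case using is_subring_diff[OF assms _ is_subring_one[OF assms]] by simp
qed

lemma is_subfield_of_rat:
  assumes "is_subfield (S :: 'a::field_char_0 set)"
  shows "of_rat q \<in> S"
proof (cases q)
  case (Fract a b)
  have S: "is_subring S" "\<And>x. x \<in> S \<Longrightarrow> inverse x \<in> S"
    using assms by (auto simp: is_subfield_def)
  have "of_int a * inverse (of_int b) \<in> S"
    by (intro is_subring_mult S is_subring_of_int)
  then show ?thesis using Fract by (simp add: of_rat_rat divide_inverse)
qed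

section \<open>Evaluation of rational polynomials and the description of \<rat>(x)\<close>

abbreviation rat_eval :: "rat poly \<Rightarrow> 'a::field_char_0 \<Rightarrow> 'a" where
  "rat_eval p x \<equiv> poly (map_poly of_rat p) x"

lemma rat_eval_pCons: "rat_eval (pCons a p) x = of_rat a + x * rat_eval p x"
  by (cases "a = 0 \<and> p = 0") (auto simp: map_poly_pCons)

lemma rat_eval_add: "rat_eval (p + q) x = rat_eval p x + rat_eval q x"
  by (induction p q rule: poly_induct2)
    (simp_all add: rat_eval_pCons of_rat_add algebra_simps)

lemma rat_eval_smult: "rat_eval (smult c p) x = of_rat c * rat_eval p x"
  by (induction p) (auto simp: rat_eval_pCons of_rat_mult algebra_simps)

lemma rat_eval_mult: "rat_eval (p * q) x = rat_eval p x * rat_eval q x"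
  by (induction p)
    (simp_all add: rat_eval_pCons rat_eval_add rat_eval_smult algebra_simps)

lemma rat_eval_diff: "rat_eval (p - q) x = rat_eval p x - rat_eval q x"
  using rat_eval_add[of "p - q" q x] by simp

text \<open>An irreducible \<open>p\<close> not dividing \<open>q\<close> is coprime to it, and
  evaluating a Bezout identity at the root \<open>x\<close> kills the \<open>p\<close>-term. This
  yields both inverses in \<rat>(x) and the divisibility property of the minimal polynomial.\<close>

lemma rat_eval_mult_inverse:
  assumes p: "is_minimal_poly p x" and ndvd: "\<not> p dvd q"
  obtains v where "rat_eval v x * rat_eval q x = 1"
proof -
  have irr: "irreducible p" and root: "rat_eval p x = 0"
    using p by (auto simp: is_minimal_poly_def)
  have "coprime p q"
    using irr ndvd by (meson field_poly_irreducible_imp_prime prime_elem_imp_coprime)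
  then obtain u v where "u * p + v * q = 1"
    using bezout_coefficients_fst_snd[of p q] by (metis coprime_imp_gcd_eq_1)
  then have "rat_eval (u * p + v * q) x = 1"
    by simp
  then have "rat_eval v x * rat_eval q x = 1"
    using root by (simp add: rat_eval_add rat_eval_mult)
  then show ?thesis by (rule that)
qed

lemma minimal_poly_dvd:
  assumes "is_minimal_poly p x" "rat_eval q x = 0"
  shows "p dvd q"
  using rat_eval_mult_inverse[OF assms(1), of q] assms(2) by fastforce

text \<open>Polynomial values at \<open>x\<close> already form a subfield: the Bezout cofactor
  supplies the inverse of a nonzero value.\<close>

lemma rat_adjoin_subset_rat_eval:
  assumes "is_minimal_poly p x"
  shows "rat_adjoin x \<subseteq> range (\<lambda>q. rat_eval q x)"
proof -
  have "is_subfield (range (\<lambda>q. rat_eval q x))"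
    unfolding is_subfield_def is_subring_def
  proof (intro conjI ballI)
    show "1 \<in> range (\<lambda>q. rat_eval q x)"
      by (rule image_eqI[of _ _ 1]) auto
  next
    fix y z assume "y \<in> range (\<lambda>q. rat_eval q x)" "z \<in> range (\<lambda>q. rat_eval q x)"
    then obtain q r where "y = rat_eval q x" "z = rat_eval r x" by blast
    then show "y - z \<in> range (\<lambda>q. rat_eval q x)" "y * z \<in> range (\<lambda>q. rat_eval q x)"
      by (metis rangeI rat_eval_diff, metis rangeI rat_eval_mult)
  next
    fix y assume "y \<in> range (\<lambda>q. rat_eval q x)"
    then obtain q where y: "y = rat_eval q x" by blast
    show "inverse y \<in> range (\<lambda>q. rat_eval q x)"
    proof (cases "y = 0")
      case True
      then show ?thesis by (intro image_eqI[of _ _ 0]) auto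
    next
      case False
      have "\<not> p dvd q"
        using False assms y by (auto simp: rat_eval_mult is_minimal_poly_def elim!: dvdE)
      then obtain v where "rat_eval v x * y = 1"
        using rat_eval_mult_inverse[OF assms] y by blast
      then have "inverse y = rat_eval v x"
        using False by (simp add: field_simps)
      then show ?thesis by blast
    qed
  qed
  moreover have "x \<in> range (\<lambda>q. rat_eval q x)"
    by (rule image_eqI[of _ _ "[:0, 1:]"]) (auto simp: rat_eval_pCons)
  ultimately show ?thesis
    unfolding rat_adjoin_def by (intro hull_minimal) auto
qed

lemma rat_eval_in_subfield:
  assumes "is_subfield S" "x \<in> S"
  shows "rat_eval q x \<in> S"
proof (induction q)
  case 0
  then show ?case using is_subring_zero[of S] assms by (auto simp: is_subfield_def)
next
  case (pCons a q)
  have "is_subring S" using assms by (simp add: is_subfield_def)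
  then show ?case
    using pCons assms is_subfield_of_rat[of S a]
    by (auto simp: rat_eval_pCons intro!: is_subring_add is_subring_mult)
qed

lemma rat_adjoin_eq_rat_eval:
  assumes "is_minimal_poly p x"
  shows "rat_adjoin x = range (\<lambda>q. rat_eval q x)"
proof
  have "x \<in> rat_adjoin x"
    unfolding rat_adjoin_def by (rule hull_inc) simp
  then show "range (\<lambda>q. rat_eval q x) \<subseteq> rat_adjoin x"
    using rat_eval_in_subfield is_subfield_hull unfolding rat_adjoin_def by blast
qed (rule rat_adjoin_subset_rat_eval[OF assms])

section \<open>Embeddings, traces and total positivity in terms of the roots of the minimal
  polynomial\<close>

lemma embedding_zero:
  assumes "\<sigma> \<in> embeddings K" "is_subring K"
  shows "\<sigma> 0 = 0"
proof -
  have "\<sigma> (0 + 0) = \<sigma> 0 + \<sigma> 0"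
    using assms is_subring_zero[OF assms(2)] unfolding embeddings_def by blast
  then show ?thesis
    by (metis add.right_neutral add_left_cancel)
qed

lemma embedding_of_rat:
  fixes \<sigma> :: "'a::field_char_0 \<Rightarrow> 'b::field_char_0"
  assumes \<sigma>: "\<sigma> \<in> embeddings K" and K: "is_subfield K"
  shows "\<sigma> (of_rat q) = of_rat q"
proof -
  have hom: "\<sigma> 1 = 1" "\<And>x y. x \<in> K \<Longrightarrow> y \<in> K \<Longrightarrow> \<sigma> (x + y) = \<sigma> x + \<sigma> y"
    "\<And>x y. x \<in> K \<Longrightarrow> y \<in> K \<Longrightarrow> \<sigma> (x * y) = \<sigma> x * \<sigma> y"
    using \<sigma> by (auto simp: embeddings_def)
  have R: "is_subring K" using K by (simp add: is_subfield_def)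
  have int: "\<sigma> (of_int k) = of_int k" for k
  proof (induction k rule: int_induct[where k = 0])
    case base
    then show ?case using embedding_zero[OF \<sigma> R] by simp
  next
    case (step1 i)
    then show ?case
      using hom(2)[OF is_subring_of_int[OF R] is_subring_one[OF R], of i] hom(1) by simp
  next
    case (step2 i)
    then show ?case
      using hom(2)[OF is_subring_of_int[OF R] is_subring_one[OF R], of "i - 1"] hom(1)
      by (simp add: algebra_simps)
  qed
  obtain a b where q: "q = Rat.Fract a b" "b > 0" by (cases q)
  have "of_rat q * of_int b = (of_int a :: 'a)"
    using q by (simp add: of_rat_rat)
  then have "\<sigma> (of_rat q) * \<sigma> (of_int b) = \<sigma> (of_int a)"
    using hom(3)[OF is_subfield_of_rat[OF K] is_subring_of_int[OF R], of q b] by simp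
  then show ?thesis
    using q by (simp add: int of_rat_rat field_simps)
qed

lemma embedding_rat_eval:
  fixes \<sigma> :: "'a::field_char_0 \<Rightarrow> 'b::field_char_0"
  assumes \<sigma>: "\<sigma> \<in> embeddings K" and K: "is_subfield K" and x: "x \<in> K"
  shows "\<sigma> (rat_eval q x) = rat_eval q (\<sigma> x)"
proof (induction q)
  case 0
  then show ?case
    using embedding_zero[OF \<sigma>] K by (simp add: is_subfield_def)
next
  case (pCons a q)
  have R: "is_subring K" using K by (simp add: is_subfield_def)
  have hom: "\<And>x y. x \<in> K \<Longrightarrow> y \<in> K \<Longrightarrow> \<sigma> (x + y) = \<sigma> x + \<sigma> y"
    "\<And>x y. x \<in> K \<Longrightarrow> y \<in> K \<Longrightarrow> \<sigma> (x * y) = \<sigma> x * \<sigma> y"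
    using \<sigma> by (auto simp: embeddings_def)
  have in_K: "rat_eval q x \<in> K"
    by (rule rat_eval_in_subfield[OF K x])
  show ?case
    using hom(1)[OF is_subfield_of_rat[OF K, of a] is_subring_mult[OF R x in_K]]
      hom(2)[OF x in_K] pCons embedding_of_rat[OF \<sigma> K, of a]
    by (simp add: rat_eval_pCons)
qed

text \<open>The substitution of \<open>r\<close> for \<open>x\<close>, made through an arbitrarily
  chosen polynomial representing \<open>y\<close>. The restricted lambda makes it extensional, as
  membership in \<open>embeddings\<close> demands.\<close>

definition root_embedding :: "'a::field_char_0 \<Rightarrow> 'b::field_char_0 \<Rightarrow> 'a \<Rightarrow> 'b" where
  "root_embedding x r = (\<lambda>y \<in> rat_adjoin x. rat_eval (SOME q. rat_eval q x = y) r)"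

text \<open>Independence of the chosen representative: two of them differ by a multiple of
  \<open>p\<close>, which vanishes at \<open>r\<close>.\<close>

lemma root_embedding_rat_eval:
  assumes p: "is_minimal_poly p x" and r: "rat_eval p r = 0"
  shows "root_embedding x r (rat_eval q x) = rat_eval q r"
proof -
  define q' where "q' = (SOME q'. rat_eval q' x = rat_eval q x)"
  have "rat_eval q' x = rat_eval q x"
    unfolding q'_def by (rule someI[of _ q]) simp
  then have "p dvd q' - q"
    by (intro minimal_poly_dvd[OF p]) (simp add: rat_eval_diff)
  then have "rat_eval (q' - q) r = 0"
    using r by (auto simp: rat_eval_mult elim!: dvdE)
  then have "rat_eval q' r = rat_eval q r"
    by (simp add: rat_eval_diff)
  then show ?thesis
    using rat_adjoin_eq_rat_eval[OF p] by (simp add: root_embedding_def q'_def)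
qed

text \<open>An embedding fixes the rationals, so it is determined by the image of \<open>x\<close>,
  again a root of \<open>p\<close>; conversely substitution of any root is a homomorphism. The
  target field stays general: real values serve trace and positivity, complex values serve total
  reality.\<close>

lemma embeddings_rat_adjoin:
  fixes x :: "'a::field_char_0"
  assumes p: "is_minimal_poly p x"
  shows "embeddings (rat_adjoin x) =
    root_embedding x ` {r :: 'b::field_char_0. rat_eval p r = 0}"
proof (intro equalityI subsetI)
  let ?K = "rat_adjoin x"
  have K: "is_subfield ?K" and x: "x \<in> ?K"
    unfolding rat_adjoin_def by (rule is_subfield_hull) (rule hull_inc, simp)
  fix \<sigma> :: "'a \<Rightarrow> 'b" assume \<sigma>: "\<sigma> \<in> embeddings ?K"
  have "rat_eval p (\<sigma> x) = \<sigma> (rat_eval p x)"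
    using embedding_rat_eval[OF \<sigma> K x] by simp
  also have "\<dots> = 0"
    using p embedding_zero[OF \<sigma>] K by (simp add: is_minimal_poly_def is_subfield_def)
  finally have root: "rat_eval p (\<sigma> x) = 0" .
  have "\<sigma> = root_embedding x (\<sigma> x)"
  proof
    fix y
    show "\<sigma> y = root_embedding x (\<sigma> x) y"
    proof (cases "y \<in> ?K")
      case True
      then obtain q where "y = rat_eval q x"
        using rat_adjoin_eq_rat_eval[OF p] by auto
      then show ?thesis
        using root_embedding_rat_eval[OF p root] embedding_rat_eval[OF \<sigma> K x] by simp
    next
      case False
      moreover have "\<sigma> \<in> extensional ?K"
        using \<sigma> by (simp add: embeddings_def)
      ultimately show ?thesis
        by (simp add: root_embedding_def extensional_arb[of \<sigma> ?K])
    qed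
  qed
  then show "\<sigma> \<in> root_embedding x ` {r. rat_eval p r = 0}"
    using root by blast
next
  fix \<sigma> :: "'a \<Rightarrow> 'b" assume "\<sigma> \<in> root_embedding x ` {r. rat_eval p r = 0}"
  then obtain r where r: "rat_eval p r = 0" and \<sigma>: "\<sigma> = root_embedding x r" by blast
  note ev = root_embedding_rat_eval[OF p r]
  have "\<sigma> 1 = 1"
    using ev[of 1] \<sigma> by simp
  moreover have "\<sigma> (rat_eval q x + rat_eval q' x) = \<sigma> (rat_eval q x) + \<sigma> (rat_eval q' x)"
    "\<sigma> (rat_eval q x * rat_eval q' x) = \<sigma> (rat_eval q x) * \<sigma> (rat_eval q' x)" for q q'
    using ev[of "q + q'"] ev[of "q * q'"] ev[of q] ev[of q'] \<sigma>
    by (simp_all add: rat_eval_add rat_eval_mult)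
  moreover have "\<sigma> \<in> extensional (rat_adjoin x)"
    by (simp add: \<sigma> root_embedding_def)
  ultimately show "\<sigma> \<in> embeddings (rat_adjoin x)"
    unfolding embeddings_def rat_adjoin_eq_rat_eval[OF p] by auto
qed

lemma root_embedding_generator:
  assumes "is_minimal_poly p x" "rat_eval p r = 0"
  shows "root_embedding x r x = r"
  using root_embedding_rat_eval[OF assms, of "[:0, 1:]"] by (simp add: rat_eval_pCons)

text \<open>Distinct roots give distinct embeddings, since each root is recovered as the image of
  \<open>x\<close>; the sum over embeddings can therefore be reindexed by roots.\<close>

lemma field_trace_rat_eval:
  assumes p: "is_minimal_poly p x"
  shows "field_trace (rat_adjoin x) (rat_eval q x) =
    (\<Sum>r | rat_eval p r = (0::real). rat_eval q r)"
proof -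
  have "inj_on (root_embedding x) {r :: real. rat_eval p r = 0}"
    by (rule inj_onI) (metis (mono_tags) mem_Collect_eq p root_embedding_generator)
  then show ?thesis
    unfolding field_trace_def embeddings_rat_adjoin[OF p]
    by (simp add: sum.reindex root_embedding_rat_eval[OF p])
qed

lemma totally_positive_rat_eval_iff:
  assumes p: "is_minimal_poly p x"
  shows "totally_positive (rat_adjoin x) (rat_eval q x) \<longleftrightarrow>
    (\<forall>r::real. rat_eval p r = 0 \<longrightarrow> rat_eval q r > 0)"
proof -
  have "rat_eval q x \<in> rat_adjoin x"
    using rat_adjoin_eq_rat_eval[OF p] by blast
  then show ?thesis
    unfolding totally_positive_def embeddings_rat_adjoin[OF p]
    by (auto simp: root_embedding_rat_eval[OF p])
qed

lemma rat_eval_of_real: "rat_eval q (complex_of_real x) = of_real (rat_eval q x)"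
proof (induction q)
  case (pCons a q)
  have "complex_of_rat a = of_real (of_rat a)"
    by (cases a) (simp add: of_rat_rat)
  then show ?case
    using pCons by (simp add: rat_eval_pCons)
qed simp

lemma totally_real_rat_adjoin:
  assumes p: "is_minimal_poly p x"
    and roots: "\<And>r :: complex. rat_eval p r = 0 \<Longrightarrow> r \<in> \<real>"
  shows "totally_real (rat_adjoin x)"
  unfolding totally_real_def embeddings_rat_adjoin[OF p]
proof (clarsimp)
  fix r :: complex and y assume r: "rat_eval p r = 0" and "y \<in> rat_adjoin x"
  then obtain q where y: "y = rat_eval q x"
    using rat_adjoin_eq_rat_eval[OF p] by auto
  obtain t where "r = complex_of_real t"
    using roots[OF r] by (elim Reals_cases)
  then show "root_embedding x r y \<in> \<real>"
    using y root_embedding_rat_eval[OF p r, of q] by (simp add: rat_eval_of_real)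
qed

text \<open>A proper factorization in degree 3 has a linear factor, and that factor has a
  root.\<close>

lemma irreducible_cubic:
  fixes p :: "'a::field poly"
  assumes deg: "degree p = 3" and no_root: "\<And>r. poly p r \<noteq> 0"
  shows "irreducible p"
proof (rule irreducibleI)
  show "p \<noteq> 0"
    using deg by auto
  then show "\<not> p dvd 1"
    using deg by (simp add: is_unit_iff_degree)
  have linear: "\<exists>r. poly q r = 0" if "degree q = 1" for q :: "'a poly"
  proof -
    obtain c q' where q: "q = pCons c q'" by (cases q)
    then have "degree q' = 0" "q' \<noteq> 0"
      using that by (auto split: if_splits)
    then obtain d where "q = [:c, d:]" "d \<noteq> 0"
      using q by (metis degree_eq_zeroE pCons_0_0)
    then show ?thesis by (intro exI[of _ "- c / d"]) simp
  qed
  fix q r assume pqr: "p = q * r"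
  then have nz: "q \<noteq> 0" "r \<noteq> 0" using \<open>p \<noteq> 0\<close> by auto
  then have "degree q + degree r = 3"
    using deg pqr by (simp add: degree_mult_eq)
  moreover have "degree q \<noteq> 1" "degree r \<noteq> 1"
    using linear[of q] linear[of r] no_root pqr by auto
  ultimately have "degree q = 0 \<or> degree r = 0" by linarith
  then show "q dvd 1 \<or> r dvd 1"
    using nz by (auto simp: is_unit_iff_degree)
qed

subsection \<open>The roots of the cubic\<close>

text \<open>The function \<open>f\<close> equals -1 at 0, \<open>a\<close> and \<open>b\<close> and
  is positive at 1/2, \<open>a - 1/2\<close> and \<open>b + 1\<close>. The intermediate value
  theorem gives the roots, and nonvanishing at the endpoints makes the bounds strict.\<close>

lemma cubic_real_roots:
  fixes a b :: real
  assumes "a \<ge> 3" "b = 9 * a"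
  obtains r0 r1 r2 where "r0 * (r0 - a) * (r0 - b) = 1" "r1 * (r1 - a) * (r1 - b) = 1"
    "r2 * (r2 - a) * (r2 - b) = 1"
    "0 < r0" "r0 < 1/2" "a - 1/2 < r1" "r1 < a" "b < r2"
proof -
  define f where "f x = x * (x - a) * (x - b) - 1" for x
  have cont: "\<forall>x. l \<le> x \<and> x \<le> u \<longrightarrow> isCont f x" for l u
    unfolding f_def by (auto intro!: continuous_intros)
  have neg: "f 0 < 0" "f a < 0" "f b < 0"
    by (simp_all add: f_def)
  have "(1/2) * ((a - 1/2) * (b - 1/2)) > (1/2) * (2 * 2)"
    using assms by (intro mult_strict_left_mono mult_strict_mono) auto
  then have pos0: "f (1/2) > 0"
    by (simp add: f_def algebra_simps)
  have "(1/2) * ((a - 1/2) * (b - a + 1/2)) > (1/2) * (2 * 2)"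
    using assms by (intro mult_strict_left_mono mult_strict_mono) auto
  then have pos1: "f (a - 1/2) > 0"
    by (simp add: f_def algebra_simps)
  have "1 * ((b + 1) * (b + 1 - a)) > 1 * (1 * 1)"
    using assms by (intro mult_strict_left_mono mult_strict_mono) auto
  then have pos2: "f (b + 1) > 0"
    by (simp add: f_def algebra_simps)
  obtain r0 where r0: "0 \<le> r0" "r0 \<le> 1/2" "f r0 = 0"
    using IVT[of f 0 0 "1/2"] neg pos0 cont by auto
  obtain r1 where r1: "a - 1/2 \<le> r1" "r1 \<le> a" "f r1 = 0"
    using IVT2[of f a 0 "a - 1/2"] neg pos1 cont by auto
  obtain r2 where r2: "b \<le> r2" "f r2 = 0"
    using IVT[of f b 0 "b + 1"] neg pos2 cont by auto
  have "r0 \<noteq> 0" "r0 \<noteq> 1/2" "r1 \<noteq> a - 1/2" "r1 \<noteq> a" "r2 \<noteq> b"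
    using neg pos0 pos1 r0 r1 r2 by (metis less_irrefl)+
  then show thesis
    using that[of r0 r1 r2] r0 r1 r2 by (auto simp: f_def)
qed

text \<open>The factor 9 makes \<open>b - r1\<close> exceed \<open>8 * a\<close>; this is the source
  of the constants 8, 1/8 and 7/8 below.\<close>

locale cubic_roots =
  fixes a b :: int and r0 r1 r2 :: real
  assumes a: "a \<ge> 3" and b: "b = 9 * a"
    and root0: "r0 * (r0 - a) * (r0 - b) = 1"
    and root1: "r1 * (r1 - a) * (r1 - b) = 1"
    and root2: "r2 * (r2 - a) * (r2 - b) = 1"
    and bounds: "0 < r0" "r0 < 1/2" "a - 1/2 < r1" "r1 < a" "b < r2"
begin

lemma real_a: "real_of_int a \<ge> 3" and real_b: "real_of_int b = 9 * a"
  using a b by simp_all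

lemma root_less: "r0 + 2 < r1" "r1 + 1 < r2"
  using bounds real_a real_b by linarith+

text \<open>Vieta's formulas by divided differences: \<open>cancel\<close> divides the difference of
  the cubic at two roots by \<open>x - y\<close>, and a second difference isolates the sum of the
  roots.\<close>

lemma sum_roots: "r0 + r1 + r2 = a + b"
  and sum_root_products: "r0 * r1 + r0 * r2 + r1 * r2 = a * b"
  and prod_roots: "r0 * r1 * r2 = 1"
proof -
  have cancel: "x^2 + x * y + y^2 - (a + b) * (x + y) + a * b = 0"
    if "x * (x - a) * (x - b) = 1" "y * (y - a) * (y - b) = 1" "x < y" for x y :: real
  proof -
    have "(x - y) * (x^2 + x * y + y^2 - (a + b) * (x + y) + a * b) =
      x * (x - a) * (x - b) - y * (y - a) * (y - b)"
      by (simp add: power2_eq_square algebra_simps)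
    then show ?thesis using that by simp
  qed
  have c1: "r0^2 + r0 * r1 + r1^2 - (a + b) * (r0 + r1) + a * b = 0"
    and c2: "r0^2 + r0 * r2 + r2^2 - (a + b) * (r0 + r2) + a * b = 0"
    using cancel root0 root1 root2 root_less by auto
  have "(r1 - r2) * (r0 + r1 + r2 - (a + b)) =
    (r0^2 + r0 * r1 + r1^2 - (a + b) * (r0 + r1) + a * b) -
    (r0^2 + r0 * r2 + r2^2 - (a + b) * (r0 + r2) + a * b)"
    by (simp add: power2_eq_square algebra_simps)
  then show sum: "r0 + r1 + r2 = a + b"
    unfolding c1 c2 using root_less by simp
  have r2: "r2 = a + b - r0 - r1"
    using sum by simp
  show prods: "r0 * r1 + r0 * r2 + r1 * r2 = a * b"
    using c1 by (simp add: r2 power2_eq_square algebra_simps)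
  have "r0 * r1 * r2 = r0 * (r0 * r0 - (r0 + r1 + r2) * r0 + (r0 * r1 + r0 * r2 + r1 * r2))"
    by (simp add: algebra_simps)
  also have "\<dots> = r0 * (r0 - a) * (r0 - b)"
    unfolding sum prods by (simp add: algebra_simps)
  finally show "r0 * r1 * r2 = 1"
    using root0 by simp
qed

text \<open>The general type covers the real roots as well as the complex ones, so that all complex
  roots turn out to be real.\<close>

lemma factorization:
  fixes z :: "'a::{real_algebra_1, field}"
  shows "z * (z - of_int a) * (z - of_int b) - 1 =
    (z - of_real r0) * (z - of_real r1) * (z - of_real r2)"
proof -
  have "(of_real r0 + of_real r1 + of_real r2 :: 'a) = of_real (r0 + r1 + r2)"
    "(of_real r0 * of_real r1 + of_real r0 * of_real r2 + of_real r1 * of_real r2 :: 'a) =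
      of_real (r0 * r1 + r0 * r2 + r1 * r2)"
    "(of_real r0 * of_real r1 * of_real r2 :: 'a) = of_real (r0 * r1 * r2)"
    by simp_all
  then have *: "(of_real r0 + of_real r1 + of_real r2 :: 'a) = of_int a + of_int b"
    "(of_real r0 * of_real r1 + of_real r0 * of_real r2 + of_real r1 * of_real r2 :: 'a) =
      of_int a * of_int b"
    "(of_real r0 * of_real r1 * of_real r2 :: 'a) = 1"
    by (simp_all add: sum_roots sum_root_products prod_roots)
  have "(z - of_real r0) * (z - of_real r1) * (z - of_real r2) =
    z^3 - (of_real r0 + of_real r1 + of_real r2) * z^2 +
    (of_real r0 * of_real r1 + of_real r0 * of_real r2 + of_real r1 * of_real r2) * z -
    of_real r0 * of_real r1 * of_real r2"
    by (simp add: power3_eq_cube power2_eq_square algebra_simps)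
  then show ?thesis
    unfolding * by (simp add: power3_eq_cube power2_eq_square algebra_simps)
qed

section \<open>Closeness of the middle root to \<open>a\<close>\<close>

lemma gap: "r1 * (a - r1) * (b - r1) = 1"
  using root1 by (simp add: algebra_simps)

lemma gap_bound: "8 * a * (r1 * (a - r1)) \<le> 1" "8 * a * (a - r1) \<le> 1"
proof -
  have "r1 * (a - r1) > 0"
    using bounds real_a by (intro mult_pos_pos) linarith+
  then have "r1 * (a - r1) * (8 * a) \<le> r1 * (a - r1) * (b - r1)"
    using bounds real_b by (intro mult_left_mono) auto
  then show *: "8 * a * (r1 * (a - r1)) \<le> 1"
    using gap by (simp add: mult.commute)
  have "1 * (a - r1) \<le> r1 * (a - r1)"
    using bounds real_a by (intro mult_right_mono) linarith+
  then have "8 * a * (a - r1) \<le> 8 * a * (r1 * (a - r1))"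
    using real_a by (intro mult_left_mono) auto
  then show "8 * a * (a - r1) \<le> 1"
    using * by linarith
qed

text \<open>Coordinates with respect to the basis \<open>1\<close>, \<open>x (x - a)\<close>, \<open>x - a\<close> of
  \<open>\<int>[x]\<close> modulo the cubic; the middle root is very close to \<open>a\<close>, where the value is
  simply \<open>s\<close>.\<close>

definition val :: "int \<Rightarrow> int \<Rightarrow> int \<Rightarrow> 'a \<Rightarrow> 'a::comm_ring_1" where
  "val s k l x = of_int s + (x - of_int a) * (of_int k * x + of_int l)"

lemma val_add: "val (s + s') (k + k') (l + l') x = val s k l x + val s' k' l' x"
  by (simp add: val_def algebra_simps)

text \<open>The coefficient \<open>k\<close> is the second divided difference of
  \<open>val s k l\<close> at the three roots. The hypotheses keep it above
  \<open>-1 / ((r2 - r1) * (r1 - r0))\<close>, and the root gaps are at least 1, so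
  \<open>k > -1\<close>.\<close>

lemma val_quadratic_nonneg:
  assumes "val s k l r0 > 0" "val s k l r1 < 1" "val s k l r2 > 0"
  shows "k \<ge> 0"
proof (rule ccontr)
  assume "\<not> k \<ge> 0"
  then have k: "real_of_int k \<le> -1" by linarith
  have "val s k l r1 * (r2 - r0) < 1 * (r2 - r0)"
    using assms root_less by (intro mult_strict_right_mono) auto
  then have "- (r2 - r0) < - (val s k l r1 * (r2 - r0))"
    by simp
  also have "\<dots> < val s k l r2 * (r1 - r0) + val s k l r0 * (r2 - r1) - val s k l r1 * (r2 - r0)"
    using assms root_less add_pos_pos[of "val s k l r2 * (r1 - r0)" "val s k l r0 * (r2 - r1)"]
    by simp
  also have "\<dots> = real_of_int k * ((r2 - r0) * (r2 - r1) * (r1 - r0))"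
    by (simp add: val_def algebra_simps)
  finally have "real_of_int k * ((r2 - r0) * (r2 - r1) * (r1 - r0)) > - (r2 - r0)" .
  also have "\<dots> \<le> -1 * ((r2 - r0) * (r2 - r1) * (r1 - r0))"
    using root_less by (intro mult_right_mono k) auto
  finally have "(r2 - r0) * (r2 - r1) * (r1 - r0) < r2 - r0"
    by simp
  moreover have "(r2 - r0) * 1 * 1 \<le> (r2 - r0) * (r2 - r1) * (r1 - r0)"
    using root_less by (intro mult_mono) auto
  ultimately show False by simp
qed

text \<open>The divided difference at \<open>r0\<close> and \<open>r1\<close> is
  \<open>k * r0 - k * (a - r1) + l\<close>, whose middle term is at most 1/8 in size. With
  \<open>l \<ge> 1\<close> the value would rise by at least 1 from \<open>r0\<close> to
  \<open>r1\<close>.\<close>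

lemma val_linear_nonpos:
  assumes "val s k l r0 > 0" "val s k l r1 < 1" "0 \<le> k" "k \<le> a - 1"
  shows "l \<le> 0"
proof (rule ccontr)
  assume "\<not> l \<le> 0"
  then have l: "real_of_int l \<ge> 1" by linarith
  have "real_of_int k * (a - r1) \<le> a * (a - r1)"
    using assms(4) bounds by (intro mult_right_mono) auto
  then have "real_of_int k * (a - r1) \<le> 1/8"
    using gap_bound by simp
  moreover have "real_of_int k * r0 \<ge> 0"
    using assms(3) bounds by simp
  ultimately have "real_of_int k * (r0 + r1 - a) + l \<ge> 1/2"
    using l by (simp add: algebra_simps)
  then have "2 * (1/2) \<le> (r1 - r0) * (real_of_int k * (r0 + r1 - a) + l)"
    using root_less by (intro mult_mono) auto
  also have "\<dots> = val s k l r1 - val s k l r0"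
    by (simp add: val_def algebra_simps)
  finally show False using assms by linarith
qed

text \<open>At \<open>r1\<close> the value exceeds \<open>s\<close> by at most
  \<open>a * (a - r1) \<le> 1/8\<close>, so positivity gives \<open>s > -1\<close>.\<close>

lemma val_constant_nonneg:
  assumes "val s k l r1 > 0" "0 \<le> k" "- (a - 1) \<le> l"
  shows "s \<ge> 0"
proof -
  have "real_of_int k * r1 \<ge> 0"
    using assms(2) bounds real_a by simp
  then have "(a - r1) * (- a) \<le> (a - r1) * (real_of_int k * r1 + l)"
    using assms(3) bounds by (intro mult_left_mono) linarith+
  then have "real_of_int s > - 1"
    using gap_bound assms(1) by (simp add: val_def algebra_simps)
  then show ?thesis by linarith
qed

text \<open>For \<open>s = 0\<close> the value is \<open>(x - a) * (k * x + l)\<close>. As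
  \<open>r1 < a < r2\<close>, the linear factor must change sign between the two roots; hence
  \<open>k \<ge> 1\<close> and \<open>l < - r1\<close>, below the permitted range.\<close>

lemma val_constant_nonzero:
  assumes "val s k l r1 > 0" "val s k l r2 > 0" "0 \<le> k" "- (a - 1) \<le> l"
  shows "s \<noteq> 0"
proof
  assume "s = 0"
  then have pos: "(r1 - a) * (k * r1 + l) > 0" "(r2 - a) * (k * r2 + l) > 0"
    using assms by (simp_all add: val_def)
  have "k * r1 + l < 0" "k * r2 + l > 0"
    using pos bounds real_a real_b by (auto simp: zero_less_mult_iff)
  then have "k \<noteq> 0" by auto
  then have "1 * r1 \<le> k * r1"
    using assms(3) bounds real_a by (intro mult_right_mono) linarith+
  then have "real_of_int l < - (a - 1/2)"
    using \<open>k * r1 + l < 0\<close> bounds by linarith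
  then show False
    using assms(4) by linarith
qed

section \<open>The indecomposable element\<close>

abbreviation alpha :: "'a \<Rightarrow> 'a::comm_ring_1" where
  "alpha \<equiv> val 1 (a - 1) (- (a - 1))"

lemma alpha_eq: "alpha x = 1 + of_int (a - 1) * ((x - 1) * (x - of_int a))"
  by (simp add: val_def algebra_simps)

text \<open>The product \<open>(x - 1) * (x - a)\<close> is positive at the outer roots. At
  \<open>r1\<close> it is negative, but even after scaling by \<open>a - 1\<close> the loss is at
  most \<open>a * (r1 * (a - r1)) \<le> 1/8\<close>.\<close>

lemma alpha_pos: "alpha r0 > 0" "alpha r2 > 0"
  and alpha_middle: "7/8 \<le> alpha r1" "alpha r1 < 1"
proof -
  have "(1 - r0) * (a - r0) > 0" "(r2 - 1) * (r2 - a) > 0"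
    using bounds real_a real_b by (intro mult_pos_pos; linarith)+
  then have "real_of_int (a - 1) * ((1 - r0) * (a - r0)) > 0"
    "real_of_int (a - 1) * ((r2 - 1) * (r2 - a)) > 0"
    using real_a by simp_all
  then show "alpha r0 > 0" "alpha r2 > 0"
    unfolding alpha_eq by (simp_all add: algebra_simps)
  have "(r1 - 1) * (a - r1) > 0"
    using bounds real_a by (intro mult_pos_pos; linarith)
  then have less: "real_of_int (a - 1) * ((r1 - 1) * (a - r1)) > 0"
    using real_a by simp
  have "(r1 - 1) * (a - r1) \<le> r1 * (a - r1)"
    using bounds by (intro mult_right_mono) auto
  then have "real_of_int (a - 1) * ((r1 - 1) * (a - r1)) \<le> a * (r1 * (a - r1))"
    using \<open>(r1 - 1) * (a - r1) > 0\<close> real_a bounds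
    by (intro mult_mono mult_nonneg_nonneg) linarith+
  then show "7/8 \<le> alpha r1" "alpha r1 < 1"
    using gap_bound less unfolding alpha_eq by (simp_all add: algebra_simps)
qed

text \<open>Each sign result confines the next coordinate: nonnegative \<open>k\<close>,
  \<open>k'\<close> are at most \<open>a - 1\<close>, then nonpositive \<open>l\<close>,
  \<open>l'\<close> are at least \<open>- (a - 1)\<close>, and finally \<open>s\<close>,
  \<open>s'\<close> are positive integers with sum 1.\<close>

lemma alpha_no_decomposition:
  assumes sum: "s + s' = 1" "k + k' = a - 1" "l + l' = - (a - 1)"
    and pos: "val s k l r0 > 0" "val s k l r1 > 0" "val s k l r2 > 0"
    and pos': "val s' k' l' r0 > 0" "val s' k' l' r1 > 0" "val s' k' l' r2 > 0"
  shows False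
proof -
  have "val s k l r1 + val s' k' l' r1 = alpha r1"
    unfolding val_add[symmetric] sum ..
  then have "val s k l r1 < 1" "val s' k' l' r1 < 1"
    using alpha_middle pos pos' by linarith+
  moreover from this have k: "k \<ge> 0" "k' \<ge> 0"
    using val_quadratic_nonneg pos pos' by blast+
  ultimately have "l \<le> 0" "l' \<le> 0"
    using val_linear_nonpos[of s k l] val_linear_nonpos[of s' k' l'] pos pos' sum(2) by auto
  then have l: "- (a - 1) \<le> l" "- (a - 1) \<le> l'"
    using sum(3) by linarith+
  have "s \<ge> 0" "s' \<ge> 0" "s \<noteq> 0" "s' \<noteq> 0"
    using val_constant_nonneg val_constant_nonzero pos pos' k l by blast+
  then show False using sum(1) by linarith
qed

text \<open>Here \<open>c0\<close>, \<open>c1\<close>, \<open>c2\<close> stand for the conjugates of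
  \<delta>, and the integrality hypotheses are its traces against the basis 1, \<open>x - a\<close>,
  \<open>x * (x - a)\<close>.\<close>

lemma alpha_trace_bound:
  fixes c0 c1 c2 :: real
  assumes c: "c0 > 0" "c1 > 0" "c2 > 0"
    and int1: "c0 + c1 + c2 \<in> \<int>"
    and intV: "c0 * (r0 - a) + c1 * (r1 - a) + c2 * (r2 - a) \<in> \<int>"
    and intW: "c0 * (r0 * (r0 - a)) + c1 * (r1 * (r1 - a)) + c2 * (r2 * (r2 - a)) \<in> \<int>"
  shows "c0 * alpha r0 + c1 * alpha r1 + c2 * alpha r2 \<ge> a"
proof -
  obtain u V W :: int
    where u: "c0 + c1 + c2 = u"
      and V: "c0 * (r0 - a) + c1 * (r1 - a) + c2 * (r2 - a) = V"
      and W: "c0 * (r0 * (r0 - a)) + c1 * (r1 * (r1 - a)) + c2 * (r2 * (r2 - a)) = W"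
    using int1 intV intW by (auto elim!: Ints_cases)
  have eq: "c0 * alpha r0 + c1 * alpha r1 + c2 * alpha r2 = u + (a - 1) * (W - V)"
    unfolding of_int_add of_int_mult of_int_diff u[symmetric] V[symmetric] W[symmetric] alpha_eq
    by (simp add: algebra_simps)
  show ?thesis
  proof (cases "W - V \<ge> 1")
    case True
    have "real_of_int u > 0"
      using u c by linarith
    then have "u \<ge> 1" by linarith
    moreover have "a - 1 \<le> (a - 1) * (W - V)"
      using True a mult_left_mono[of 1 "W - V" "a - 1"] by simp
    ultimately have "a \<le> u + (a - 1) * (W - V)" by simp
    then show ?thesis
      unfolding eq by linarith
  next
    case False
    text \<open>As \<open>e\<close> dominates \<open>V\<close> and \<open>W\<close>, either \<open>V = W = 0\<close>, which is impossible, or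
      \<open>e\<close> is not small; then \<open>c1\<close> is large, since \<open>r1\<close> is so close to \<open>a\<close>.\<close>
    define e where "e = c1 * (r1 * (a - r1))"
    \<comment> \<open>This is \<open>W - V \<le> 0\<close> with the negative contribution of
      \<open>r1\<close> moved to the right and split as \<open>e - c1 * (a - r1)\<close>.\<close>
    have WV: "c0 * ((1 - r0) * (a - r0)) + c2 * ((r2 - 1) * (r2 - a)) + c1 * (a - r1) \<le> e"
    proof -
      have "real_of_int (W - V) \<le> 0" using False by linarith
      then show ?thesis
        unfolding of_int_diff V[symmetric] W[symmetric] e_def by (simp add: algebra_simps)
    qed
    have pos0: "c0 * (a - r0) > 0" and pos1: "c1 * (a - r1) > 0" and pos2: "c2 * (r2 - a) > 0"
      using c bounds real_a real_b by (intro mult_pos_pos; linarith)+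
    \<comment> \<open>As \<open>r0 < 1/2\<close>, the factor \<open>1 - r0\<close> exceeds both 1/2
      and \<open>r0\<close>. With \<open>WV\<close> this bounds the positive and the negative parts
      of \<open>V\<close> and \<open>W\<close> by \<open>2 * e\<close>.\<close>
    have le0: "c0 * (a - r0) * (1/2) \<le> c0 * (a - r0) * (1 - r0)"
      using pos0 bounds by (intro mult_left_mono) auto
    have le0': "c0 * (a - r0) * r0 \<le> c0 * (a - r0) * (1 - r0)"
      using pos0 bounds by (intro mult_left_mono) auto
    have le2: "c2 * (r2 - a) * 1 \<le> c2 * (r2 - a) * (r2 - 1)"
      using pos2 bounds real_a real_b by (intro mult_left_mono) auto
    have pos0': "c0 * (a - r0) * r0 > 0"
      using pos0 bounds by simp
    have e: "e = c1 * (a - r1) * r1" by (simp add: e_def)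
    have WV': "c0 * (a - r0) * (1 - r0) + c2 * (r2 - a) * (r2 - 1) + c1 * (a - r1) \<le> e"
      using WV by (simp add: mult_ac)
    show ?thesis
    proof (cases "e < 1/4")
      case True
      have V': "real_of_int V = c2 * (r2 - a) - c0 * (a - r0) - c1 * (a - r1)"
        unfolding V[symmetric] by (simp add: algebra_simps)
      have W': "real_of_int W = c2 * (r2 - a) * r2 - c0 * (a - r0) * r0 - e"
        unfolding W[symmetric] e by (simp add: algebra_simps)
      have split2: "c2 * (r2 - a) * r2 = c2 * (r2 - a) * (r2 - 1) + c2 * (r2 - a)"
        by (simp add: algebra_simps)
      have "\<bar>real_of_int V\<bar> < 1"
        using V' True le0 le2 pos0 pos1 pos2 WV' by linarith
      then have "V = 0" by linarith
      have "\<bar>real_of_int W\<bar> < 1"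
        using W' split2 True le0 le0' le2 pos0 pos0' pos1 pos2 WV' by linarith
      then have "W = 0" by linarith
      \<comment> \<open>Multiplying the balance \<open>V = 0\<close> by \<open>r2\<close>
        overweights the two smaller roots, which makes \<open>W\<close> strictly positive.\<close>
      have "c0 * (a - r0) * r0 < c0 * (a - r0) * r2" "c1 * (a - r1) * r1 < c1 * (a - r1) * r2"
        using pos0 pos1 root_less by (auto intro!: mult_strict_left_mono)
      moreover have "c2 * (r2 - a) = c0 * (a - r0) + c1 * (a - r1)"
        using V' \<open>V = 0\<close> by simp
      then have "c2 * (r2 - a) * r2 = c0 * (a - r0) * r2 + c1 * (a - r1) * r2"
        by (simp only: distrib_right)
      ultimately show ?thesis
        using W' \<open>W = 0\<close> e by simp
    next
      case False
      \<comment> \<open>Since \<open>r1 * (a - r1) \<le> 1 / (8 * a)\<close>, a value of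
        \<open>e\<close> of at least 1/4 needs \<open>c1 \<ge> 2 * a\<close>; the middle term alone
        then contributes \<open>7/4 * a\<close>.\<close>
      have "8 * a * (1/4) \<le> 8 * a * e"
        using False real_a by (intro mult_left_mono) auto
      also have "\<dots> = c1 * (8 * a * (r1 * (a - r1)))"
        by (simp add: e_def)
      also have "\<dots> \<le> c1 * 1"
        using c gap_bound by (intro mult_left_mono) auto
      finally have "c1 \<ge> 2 * a" by simp
      then have "2 * a * (7/8) \<le> c1 * alpha r1"
        using alpha_middle c real_a by (intro mult_mono) auto
      moreover have "c0 * alpha r0 > 0" "c2 * alpha r2 > 0"
        using c alpha_pos by simp_all
      ultimately show ?thesis
        using real_a by simp
    qed
  qed
qed

subsection \<open>The cubic field\<close>

definition min_poly :: "rat poly" where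
  "min_poly = [:- 1, of_int (a * b), - of_int (a + b), 1:]"

lemma rat_eval_min_poly: "rat_eval min_poly z = z * (z - of_int a) * (z - of_int b) - 1"
  unfolding min_poly_def
  by (simp add: rat_eval_pCons of_rat_minus of_rat_diff of_rat_mult algebra_simps)

lemma algebraic_int_root:
  fixes z :: "'a::field_char_0"
  assumes "z * (z - of_int a) * (z - of_int b) = 1"
  shows "algebraic_int z"
proof (rule algebraic_int.intros)
  let ?p = "[:- 1, of_int (a * b), - of_int (a + b), 1:] :: 'a poly"
  show "lead_coeff ?p = 1" by simp
  show "\<forall>i. coeff ?p i \<in> \<int>"
    by (auto simp: coeff_pCons split: nat.splits)
  show "poly ?p z = 0"
    using assms by (simp add: algebra_simps)
qed

text \<open>The inverse is a root of the negated reciprocal polynomial. Inserting powers of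
  \<open>y * z = 1\<close> homogenizes it to \<open>y^3\<close> times the original equation.\<close>

lemma algebraic_int_root_inverse:
  fixes y z :: "'a::field_char_0"
  assumes z: "z * (z - of_int a) * (z - of_int b) = 1" and yz: "y * z = 1"
  shows "algebraic_int y"
proof (rule algebraic_int.intros)
  let ?p = "[:- 1, of_int (a + b), - of_int (a * b), 1:] :: 'a poly"
  show "lead_coeff ?p = 1" by simp
  show "\<forall>i. coeff ?p i \<in> \<int>"
    by (auto simp: coeff_pCons split: nat.splits)
  have "poly ?p y = y^3 - of_int a * of_int b * y^2 * (y * z) + (of_int a + of_int b) * y * (y * z)^2
      - (y * z)^3"
    unfolding yz by (simp add: power3_eq_cube power2_eq_square algebra_simps)
  also have "\<dots> = y^3 * (1 - z * (z - of_int a) * (z - of_int b))"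
    by (simp add: power3_eq_cube power2_eq_square algebra_simps)
  finally show "poly ?p y = 0"
    using z by simp
qed

text \<open>A rational root would be an integer \<open>t\<close> with both \<open>t\<close> and
  \<open>t - a\<close> units, hence at distance at most 2, while \<open>a \<ge> 3\<close>.\<close>

lemma min_poly_no_rational_root: "poly min_poly q \<noteq> 0"
proof
  assume "poly min_poly q = 0"
  then have q: "q * (q - of_int a) * (q - of_int b) = 1"
    unfolding min_poly_def by (simp add: algebra_simps)
  then have "algebraic_int q" by (rule algebraic_int_root)
  moreover have "q \<in> \<rat>"
    by (cases q) (simp add: Fract_of_int_quotient)
  ultimately obtain t where "q = of_int t"
    using rational_algebraic_int_is_int by (metis Ints_cases)
  then have "of_int (t * (t - a) * (t - b)) = (1 :: rat)"
    using q by simp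
  then have t: "t * (t - a) * (t - b) = 1"
    by (simp only: of_int_eq_1_iff)
  then have "t dvd 1" "t - a dvd 1"
    by (metis dvd_triv_left mult.assoc, metis dvd_triv_left mult.assoc mult.commute)
  then have "\<bar>t\<bar> = 1" "\<bar>t - a\<bar> = 1" by simp_all
  then show False using a by linarith
qed

lemma is_minimal_poly_min_poly:
  assumes "z * (z - of_int a) * (z - of_int b) = 1"
  shows "is_minimal_poly min_poly z"
proof -
  have "degree min_poly = 3" "lead_coeff min_poly = 1"
    by (simp_all add: min_poly_def)
  then show ?thesis
    using assms irreducible_cubic[OF _ min_poly_no_rational_root]
    by (simp add: is_minimal_poly_def rat_eval_min_poly)
qed

lemma min_poly_roots:
  "rat_eval min_poly z = 0 \<longleftrightarrow> z \<in> {of_real r0, of_real r1, of_real r2}"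
  unfolding rat_eval_min_poly factorization by auto

lemma min_poly_real_roots: "{r. rat_eval min_poly r = 0} = {r0, r1, r2}"
  unfolding min_poly_roots by auto

definition \<rho> :: complex where "\<rho> = of_real r0"

abbreviation K :: "complex set" where "K \<equiv> rat_adjoin \<rho>"

lemma rho_root: "\<rho> * (\<rho> - of_int a) * (\<rho> - of_int b) = 1"
proof -
  have "\<rho> * (\<rho> - of_int a) * (\<rho> - of_int b) = of_real (r0 * (r0 - a) * (r0 - b))"
    by (simp add: \<rho>_def)
  then show ?thesis using root0 by simp
qed

lemmas min_poly_rho = is_minimal_poly_min_poly[OF rho_root]

lemma cubic_unit_rho: "cubic_unit \<rho>"
proof -
  have "algebraic_int ((\<rho> - of_int a) * (\<rho> - of_int b))"
    by (rule algebraic_int_root_inverse[OF rho_root]) (use rho_root in \<open>simp add: mult_ac\<close>)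
  moreover have "\<rho> * ((\<rho> - of_int a) * (\<rho> - of_int b)) = 1"
    using rho_root by (simp add: mult_ac)
  moreover have "degree min_poly = 3"
    by (simp add: min_poly_def)
  ultimately show ?thesis
    unfolding cubic_unit_def algebraic_unit_def
    using algebraic_int_root[OF rho_root] min_poly_rho by blast
qed

lemma totally_real_K: "totally_real K"
  by (rule totally_real_rat_adjoin[OF min_poly_rho]) (auto simp: min_poly_roots)

lemma field_trace_K:
  "field_trace K (rat_eval q \<rho>) = rat_eval q r0 + rat_eval q r1 + rat_eval q r2"
  unfolding field_trace_rat_eval[OF min_poly_rho] min_poly_real_roots
  using root_less by simp

lemma totally_positive_K_iff:
  "totally_positive K (rat_eval q \<rho>) \<longleftrightarrow>
    rat_eval q r0 > 0 \<and> rat_eval q r1 > 0 \<and> rat_eval q r2 > 0"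
  unfolding totally_positive_rat_eval_iff[OF min_poly_rho] min_poly_roots by auto

section \<open>The order \<int>[\<rho>] in coordinates\<close>

definition val_poly :: "int \<Rightarrow> int \<Rightarrow> int \<Rightarrow> rat poly" where
  "val_poly s k l = [:of_int (s - a * l), of_int (l - a * k), of_int k:]"

lemma rat_eval_val_poly: "rat_eval (val_poly s k l) x = val s k l x"
  unfolding val_poly_def val_def
  by (simp add: rat_eval_pCons of_rat_diff of_rat_mult algebra_simps)

text \<open>Structure constants of the basis 1, \<open>x * V\<close>, \<open>V\<close> with
  \<open>V = x - a\<close>. They come from reducing by \<open>x * V * (x - b) = 1\<close> and show
  that the integral combinations are closed under multiplication.\<close>

lemma val_mult:
  fixes x :: "'a::comm_ring_1"
  assumes x: "x * (x - of_int a) * (x - of_int b) = 1"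
  shows "val s k l x * val s' k' l' x =
    val (s * s' + k * k' * b + (k * l' + k' * l))
      (s * k' + s' * k + k * k' * (b - a) * b + (k * l' + k' * l) * (b - a) + l * l')
      (s * l' + s' * l + k * k' - a * l * l') x"
proof -
  define V where "V = x - of_int a"
    have WV: "(x * V) * V = of_int (b - a) * (x * V) + 1"
  proof -
    have "(x * V) * V = of_int (b - a) * (x * V) + x * V * (x - of_int b)"
      by (simp add: V_def algebra_simps)
    then show ?thesis using x by (simp only: V_def)
  qed
  have WW: "(x * V) * (x * V) = of_int ((b - a) * b) * (x * V) + V + of_int b"
  proof -
    have "(x * V) * (x * V) =
      of_int ((b - a) * b) * (x * V) + (x + of_int (b - a)) * (x * V * (x - of_int b))"
      by (simp add: V_def algebra_simps)
    also have "x * V * (x - of_int b) = 1"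
      using x by (simp only: V_def)
    finally show ?thesis by (simp add: V_def)
  qed
  have val: "val s k l x = of_int s + of_int k * (x * V) + of_int l * V" for s k l
    by (simp add: val_def V_def algebra_simps)
  have "val s k l x * val s' k' l' x =
    of_int (s * s') + of_int (s * k' + s' * k) * (x * V) + of_int (s * l' + s' * l) * V +
    of_int (k * k') * ((x * V) * (x * V)) + of_int (k * l' + k' * l) * ((x * V) * V) +
    of_int (l * l') * (V * V)"
    unfolding val by (simp add: distrib_left distrib_right mult_ac add_ac)
  also have "V * V = x * V - of_int a * V"
    by (simp add: V_def algebra_simps)
  finally show ?thesis
    unfolding val WV WW
    by (simp add: distrib_left distrib_right right_diff_distrib left_diff_distrib mult_ac add_ac)
qed

lemma int_adjoin_rho: "int_adjoin \<rho> = {val s k l \<rho> | s k l. True}"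
proof
  let ?S = "{val s k l \<rho> | s k l. True}"
  have "val s k l \<rho> - val s' k' l' \<rho> = val (s - s') (k - k') (l - l') \<rho>" for s k l s' k' l'
    by (simp add: val_def algebra_simps)
  moreover have "1 = val 1 0 0 \<rho>"
    by (simp add: val_def)
  ultimately have "is_subring ?S"
    unfolding is_subring_def using val_mult[OF rho_root] by blast
  moreover have "\<rho> = val a 0 1 \<rho>"
    by (simp add: val_def)
  then have "{\<rho>} \<subseteq> ?S" by blast
  ultimately show "int_adjoin \<rho> \<subseteq> ?S"
    unfolding int_adjoin_def by (intro hull_minimal)
next
  have R: "is_subring (int_adjoin \<rho>)" and \<rho>: "\<rho> \<in> int_adjoin \<rho>"
    unfolding int_adjoin_def by (rule is_subring_hull) (rule hull_inc, simp)
  show "{val s k l \<rho> | s k l. True} \<subseteq> int_adjoin \<rho>"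
    unfolding val_def
    by (auto intro!: is_subring_add[OF R] is_subring_mult[OF R] is_subring_diff[OF R]
        is_subring_of_int[OF R] \<rho>)
qed

lemma val_in_positive_part_iff:
  "val s k l \<rho> \<in> positive_part K (int_adjoin \<rho>) \<longleftrightarrow>
    val s k l r0 > 0 \<and> val s k l r1 > 0 \<and> val s k l r2 > 0"
  using totally_positive_K_iff[of "val_poly s k l"] int_adjoin_rho
  by (auto simp: positive_part_def rat_eval_val_poly)

text \<open>The minimal polynomial has degree 3 and divides a difference of degree at most 2, so
  that difference is zero; the coefficients are triangular in the coordinates.\<close>

lemma val_inject:
  assumes "val s k l \<rho> = val s' k' l' \<rho>"
  shows "s = s'" "k = k'" "l = l'"
proof -
  let ?d = "val_poly s k l - val_poly s' k' l'"
  have "min_poly dvd ?d"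
    using assms by (intro minimal_poly_dvd[OF min_poly_rho])
      (simp add: rat_eval_diff rat_eval_val_poly)
  moreover have "degree ?d < degree min_poly"
    by (simp add: val_poly_def min_poly_def)
  ultimately have "?d = 0"
    using dvd_imp_degree_le[of min_poly ?d] by linarith
  then have "k = k'" "l - a * k = l' - a * k'" "s - a * l = s' - a * l'"
    unfolding val_poly_def by (auto simp flip: of_int_diff of_int_mult)
  then show "s = s'" "k = k'" "l = l'" by auto
qed

lemma alpha_indecomposable: "indecomposable K (int_adjoin \<rho>) (alpha \<rho>)"
  unfolding indecomposable_def
proof (intro conjI notI)
  show "alpha \<rho> \<in> positive_part K (int_adjoin \<rho>)"
    unfolding val_in_positive_part_iff using alpha_pos alpha_middle by simp
  assume "\<exists>y\<in>positive_part K (int_adjoin \<rho>).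
    \<exists>z\<in>positive_part K (int_adjoin \<rho>). alpha \<rho> = y + z"
  then obtain y z where yz: "y \<in> positive_part K (int_adjoin \<rho>)"
    "z \<in> positive_part K (int_adjoin \<rho>)" "alpha \<rho> = y + z" by blast
  moreover from this obtain s k l s' k' l' where val: "y = val s k l \<rho>" "z = val s' k' l' \<rho>"
    unfolding positive_part_def int_adjoin_rho by blast
  ultimately have "alpha \<rho> = val (s + s') (k + k') (l + l') \<rho>"
    by (simp add: val_add)
  note sum = val_inject[OF this, symmetric]
  show False
    using alpha_no_decomposition[OF sum] yz(1,2) unfolding val val_in_positive_part_iff by blast
qed

lemma field_trace_val_mult:
  "field_trace K (val s k l \<rho> * rat_eval q \<rho>) =
    val s k l r0 * rat_eval q r0 + val s k l r1 * rat_eval q r1 + val s k l r2 * rat_eval q r2"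
  using field_trace_K[of "val_poly s k l * q"] by (simp add: rat_eval_mult rat_eval_val_poly)

section \<open>Traces against the codifferent and existence of the minimum\<close>

abbreviation positive_codifferent :: "complex set" where
  "positive_codifferent \<equiv> positive_part K (codifferent K (int_adjoin \<rho>))"

lemma alpha_trace_int:
  assumes "\<delta> \<in> positive_codifferent"
  shows "field_trace K (alpha \<rho> * \<delta>) \<in> \<int>"
  using assms int_adjoin_rho unfolding positive_part_def codifferent_def by blast

lemma alpha_trace_ge:
  assumes \<delta>: "\<delta> \<in> positive_codifferent"
  shows "field_trace K (alpha \<rho> * \<delta>) \<ge> a"
proof -
  obtain q where q: "\<delta> = rat_eval q \<rho>"
    using \<delta> rat_adjoin_eq_rat_eval[OF min_poly_rho] by (auto simp: positive_part_def codifferent_def)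
  have pos: "rat_eval q r0 > 0" "rat_eval q r1 > 0" "rat_eval q r2 > 0"
    using \<delta> totally_positive_K_iff[of q] unfolding q positive_part_def by blast+
  have int: "val s k l r0 * rat_eval q r0 + val s k l r1 * rat_eval q r1 +
    val s k l r2 * rat_eval q r2 \<in> \<int>" for s k l
  proof -
    have "val s k l \<rho> \<in> int_adjoin \<rho>"
      using int_adjoin_rho by blast
    then have "field_trace K (val s k l \<rho> * \<delta>) \<in> \<int>"
      using \<delta> unfolding positive_part_def codifferent_def by blast
    then show ?thesis
      unfolding q field_trace_val_mult .
  qed
  show ?thesis
    using alpha_trace_bound[OF pos] int[of 1 0 0] int[of 0 0 1] int[of 0 1 0]
    unfolding q field_trace_val_mult by (simp add: val_def mult_ac)
qed

text \<open>This makes the set over which the minimum is taken nonempty. Traces of elements of the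
  order are integers by Vieta and the formula for the sum of squares.\<close>

lemma one_in_positive_codifferent: "1 \<in> positive_codifferent"
proof -
  have 1: "1 = rat_eval 1 \<rho>" by simp
  have "field_trace K (x * 1) \<in> \<int>" if x: "x \<in> int_adjoin \<rho>" for x
  proof -
    obtain s k l where x: "x = val s k l \<rho>"
      using x int_adjoin_rho by blast
    have "r0^2 + r1^2 + r2^2 = (r0 + r1 + r2)^2 - 2 * (r0 * r1 + r0 * r2 + r1 * r2)"
      by (simp add: power2_eq_square algebra_simps)
    then have squares: "r0^2 + r1^2 + r2^2 = (a + b)^2 - 2 * (a * b)"
      unfolding sum_roots sum_root_products by simp
    have "val s k l r0 + val s k l r1 + val s k l r2 =
      3 * s + k * ((r0^2 + r1^2 + r2^2) - a * (r0 + r1 + r2)) + l * ((r0 + r1 + r2) - 3 * a)"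
      by (simp add: val_def power2_eq_square algebra_simps)
    also have "\<dots> \<in> \<int>"
      unfolding squares sum_roots by (intro Ints_add Ints_diff Ints_mult Ints_power) auto
    finally show ?thesis
      unfolding x 1 field_trace_val_mult by simp
  qed
  moreover have "1 \<in> K"
    using rat_adjoin_eq_rat_eval[OF min_poly_rho] 1 by blast
  moreover have "totally_positive K 1"
    using totally_positive_K_iff[of 1] by simp
  ultimately show ?thesis
    by (simp add: positive_part_def codifferent_def)
qed

text \<open>The traces are nonnegative integers, so a least one exists by well-ordering of the
  naturals.\<close>

lemma exists_min_trace:
  "\<exists>\<delta>. is_arg_min (\<lambda>\<delta>. field_trace K (alpha \<rho> * \<delta>)) (\<lambda>\<delta>. \<delta> \<in> positive_codifferent) \<delta>"
proof -
  let ?t = "\<lambda>\<delta>. field_trace K (alpha \<rho> * \<delta>)"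
  have nat: "?t \<delta> = real (nat \<lfloor>?t \<delta>\<rfloor>)" if "\<delta> \<in> positive_codifferent" for \<delta>
  proof -
    have "?t \<delta> = of_int \<lfloor>?t \<delta>\<rfloor>"
      using alpha_trace_int[OF that] by (metis floor_of_int Ints_cases)
    moreover have "?t \<delta> \<ge> 0"
      using alpha_trace_ge[OF that] real_a by linarith
    ultimately show ?thesis by simp
  qed
  obtain \<delta> where \<delta>: "\<delta> \<in> positive_codifferent"
    and min: "\<And>\<epsilon>. \<epsilon> \<in> positive_codifferent \<Longrightarrow> nat \<lfloor>?t \<delta>\<rfloor> \<le> nat \<lfloor>?t \<epsilon>\<rfloor>"
    using ex_has_least_nat[where P = "\<lambda>\<delta>. \<delta> \<in> positive_codifferent",
      OF one_in_positive_codifferent, of "\<lambda>\<delta>. nat \<lfloor>?t \<delta>\<rfloor>"] by blast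
  have "?t \<delta> \<le> ?t \<epsilon>" if "\<epsilon> \<in> positive_codifferent" for \<epsilon>
    using min[OF that] nat[OF \<delta>] nat[OF that] by simp
  then show ?thesis
    using \<delta> unfolding is_arg_min_linorder by blast
qed

end

theorem theorem1p1:
  fixes n :: nat
  shows "\<exists>\<rho> :: complex. cubic_unit \<rho> \<and> totally_real (rat_adjoin \<rho>) \<and>
    (\<exists>\<alpha> \<in> int_adjoin \<rho>.
       indecomposable (rat_adjoin \<rho>) (int_adjoin \<rho>) \<alpha> \<and>
       (\<exists>\<delta>. is_arg_min (\<lambda>\<delta>. field_trace (rat_adjoin \<rho>) (\<alpha> * \<delta>))
              (\<lambda>\<delta>. \<delta> \<in> positive_part (rat_adjoin \<rho>) (codifferent (rat_adjoin \<rho>) (int_adjoin \<rho>))) \<delta> \<and>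
            field_trace (rat_adjoin \<rho>) (\<alpha> * \<delta>) > real n))"
proof -
  \<comment> \<open>The shift by 3 meets the requirement \<open>a \<ge> 3\<close> and makes the
    lower bound \<open>a\<close> exceed \<open>n\<close>.\<close>
  define a :: int where "a = int n + 3"
  obtain r0 r1 r2 :: real where roots: "r0 * (r0 - a) * (r0 - 9 * a) = 1"
    "r1 * (r1 - a) * (r1 - 9 * a) = 1" "r2 * (r2 - a) * (r2 - 9 * a) = 1"
    "0 < r0" "r0 < 1/2" "a - 1/2 < r1" "r1 < a" "9 * a < r2"
    using cubic_real_roots[of "real_of_int a" "9 * real_of_int a"] by (auto simp: a_def)
  interpret cubic_roots a "9 * a" r0 r1 r2
    by unfold_locales (use roots in \<open>auto simp: a_def\<close>)
  obtain \<delta> where \<delta>: "is_arg_min (\<lambda>\<delta>. field_trace K (alpha \<rho> * \<delta>))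
    (\<lambda>\<delta>. \<delta> \<in> positive_codifferent) \<delta>"
    using exists_min_trace by blast
  then have "field_trace K (alpha \<rho> * \<delta>) \<ge> a"
    using alpha_trace_ge unfolding is_arg_min_def by blast
  then have "field_trace K (alpha \<rho> * \<delta>) > real n"
    by (simp add: a_def)
  moreover have "alpha \<rho> \<in> int_adjoin \<rho>"
    using int_adjoin_rho by blast
  ultimately show ?thesis
    using cubic_unit_rho totally_real_K alpha_indecomposable \<delta> by blast
qed

end
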